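(* Let $N\ge3$ and $q\in\mathbb{C}^{N^2}$. There are constants in $\mathcal{B}_{123}$ if and only if $$(\sigma_{12}-1)(\sigma_{23}-1)(\sigma_{13}-1)(\sigma_{123}-1)=0.$$
   Context: Let $\mathcal{B}$ be the unital associative $\mathbb{C}$-algebra freely generated by $\xi_1,\dots,\xi_N$. Given $q=(q_{ij})\in\mathbb{C}^{N^2}$, let $\partial_i:\mathcal{B}\to\mathcal{B}$ be the linear operators determined by $\partial_i1=0$ and $\partial_i(\xi_jx)=\delta_{ij}x+q_{ij}\xi_j\partial_ix$. A constant is a nonzero element $C$ of $\mathcal{B}$ with zero degree-$0$ component such that $\partial_iC=0$ for all $i=1,\dots,N$. $\mathcal{B}_{123}$ is the space of polynomials separately linear in $\xi_1,\xi_2,\xi_3$, i.e. the $6$-dimensional span of the monomials $\xi_{i}\xi_{j}\xi_{k}$ with $(i,j,k)$ a permutation of $(1,2,3)$. $\sigma_{ij}=q_{ij}q_{ji}$ and $\sigma_{123}=\sigma_{12}\sigma_{13}\sigma_{23}$. *)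

theory Defs
  imports Complex_Main "HOL-Library.Poly_Mapping"
begin

text \<open>
  The monoid of words is written additively because \<^theory>\<open>HOL-Library.Poly_Mapping\<close> provides the
  monoid-algebra product for an additive monoid of exponents; \<open>+\<close> is (non-commutative) concatenation.
\<close>

datatype word = Word (letters: "nat list")

instantiation word :: monoid_add
begin

definition zero_word :: word where "0 = Word []"
definition plus_word :: "word \<Rightarrow> word \<Rightarrow> word" where "u + v = Word (letters u @ letters v)"

instance by standard (simp_all add: zero_word_def plus_word_def)

end

lemma poly_mapping_additive_induct [case_names single sum]:
  fixes x :: "'a \<Rightarrow>\<^sub>0 'b::comm_monoid_add"
  assumes "\<And>k v. P (Poly_Mapping.single k v)" and "\<And>f g. P f \<Longrightarrow> P g \<Longrightarrow> P (f + g)"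
  shows "P x"
proof (induction x rule: update_induct)
  case const
  then show ?case using assms(1)[of undefined 0] by simp
next
  case (update f a b)
  have "Poly_Mapping.update a b f = Poly_Mapping.single a b + f"
    using update by (auto simp: poly_mapping_eq_iff fun_eq_iff lookup_add lookup_single
        lookup_update when_def in_keys_iff)
  then show ?case using assms update by metis
qed

text \<open>The free unital associative algebra over the complex numbers on the generators \<open>\<xi> i\<close>, \<open>i :: nat\<close>.\<close>

type_synonym freealg = "word \<Rightarrow>\<^sub>0 complex"

definition \<xi> :: "nat \<Rightarrow> freealg" where
  "\<xi> i = Poly_Mapping.single (Word [i]) 1"

definition scale :: "complex \<Rightarrow> freealg \<Rightarrow> freealg" where
  "scale c x = Poly_Mapping.map ((*) c) x"

lemma lookup_scale [simp]: "Poly_Mapping.lookup (scale c x) w = c * Poly_Mapping.lookup x w"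
  unfolding scale_def by transfer (simp add: when_def)

interpretation freealg: vector_space scale
  by unfold_locales (simp_all add: poly_mapping_eq_iff fun_eq_iff lookup_add algebra_simps)

lemma scale_single: "scale c (Poly_Mapping.single w a) = Poly_Mapping.single w (c * a)"
  by (simp add: poly_mapping_eq_iff fun_eq_iff lookup_single when_def)

lemma scale_eq_mult: "scale c x = Poly_Mapping.single 0 c * x"
proof (induction x rule: poly_mapping_additive_induct)
  case (single k v)
  then show ?case by (simp add: scale_single mult_single)
next
  case (sum f g)
  then show ?case by (simp add: freealg.scale_right_distrib distrib_left)
qed

lemma mult_scale_right: "x * scale c y = scale c (x * y)"
proof -
  have "x * Poly_Mapping.single 0 c = Poly_Mapping.single 0 c * x"
  proof (induction x rule: poly_mapping_additive_induct)
    case (single k v)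
    then show ?case by (simp add: mult_single mult.commute)
  next
    case (sum f g)
    then show ?case by (simp add: distrib_left distrib_right)
  qed
  then show ?thesis by (simp add: scale_eq_mult flip: mult.assoc)
qed

text \<open>The algebra freely generated by \<open>\<xi> 1, \<dots>, \<xi> N\<close>, as a subalgebra.\<close>

definition \<B> :: "nat \<Rightarrow> freealg set" where
  "\<B> N = {x. \<forall>w\<in>Poly_Mapping.keys x. set (letters w) \<subseteq> {1..N}}"

text \<open>
  The operators \<open>partial q i\<close>, computed first on words; the lemmas below show that they are the
  linear operators determined by \<open>\<partial>\<^sub>i 1 = 0\<close> and
  \<open>\<partial>\<^sub>i (\<xi>\<^sub>j x) = \<delta>\<^sub>i\<^sub>j x + q\<^sub>i\<^sub>j \<xi>\<^sub>j \<partial>\<^sub>i x\<close>.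
\<close>

primrec partial_word :: "(nat \<Rightarrow> nat \<Rightarrow> complex) \<Rightarrow> nat \<Rightarrow> nat list \<Rightarrow> freealg" where
  "partial_word q i [] = 0"
| "partial_word q i (j # w) =
     (if i = j then Poly_Mapping.single (Word w) 1 else 0) + scale (q i j) (\<xi> j * partial_word q i w)"

definition partial :: "(nat \<Rightarrow> nat \<Rightarrow> complex) \<Rightarrow> nat \<Rightarrow> freealg \<Rightarrow> freealg" where
  "partial q i x = (\<Sum>w\<in>Poly_Mapping.keys x. scale (Poly_Mapping.lookup x w) (partial_word q i (letters w)))"

lemma partial_superset:
  assumes "finite A" "Poly_Mapping.keys x \<subseteq> A"
  shows "partial q i x = (\<Sum>w\<in>A. scale (Poly_Mapping.lookup x w) (partial_word q i (letters w)))"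
  unfolding partial_def using assms by (intro sum.mono_neutral_left) (auto simp: in_keys_iff)

lemma partial_linear: "Vector_Spaces.linear scale scale (partial q i)"
proof -
  have "partial q i (x + y) = partial q i x + partial q i y" for x y
  proof -
    have "Poly_Mapping.keys (x + y) \<subseteq> Poly_Mapping.keys x \<union> Poly_Mapping.keys y" by (rule keys_add)
    then show ?thesis
      by (simp add: partial_superset[of "Poly_Mapping.keys x \<union> Poly_Mapping.keys y"] lookup_add freealg.scale_left_distrib
          sum.distrib)
  qed
  moreover have "partial q i (scale c x) = scale c (partial q i x)" for c x
  proof -
    have "Poly_Mapping.keys (scale c x) \<subseteq> Poly_Mapping.keys x" by (auto simp: in_keys_iff)
    then show ?thesis
      by (simp add: partial_superset[of "Poly_Mapping.keys x"] freealg.scale_sum_right)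
  qed
  ultimately show ?thesis
    by (intro Vector_Spaces.linear.intro module_hom.intro module_hom_axioms.intro
        freealg.vector_space_axioms freealg.module_axioms)
qed

lemma partial_add: "partial q i (x + y) = partial q i x + partial q i y"
  and partial_scale: "partial q i (scale c x) = scale c (partial q i x)"
proof -
  interpret Vector_Spaces.linear scale scale "partial q i" by (rule partial_linear)
  show "partial q i (x + y) = partial q i x + partial q i y" by (rule add)
  show "partial q i (scale c x) = scale c (partial q i x)" by (rule scale)
qed

lemma partial_single: "partial q i (Poly_Mapping.single w c) = scale c (partial_word q i (letters w))"
  by (simp add: partial_superset[of "{w}"])

lemma partial_one: "partial q i 1 = 0"
  by (simp add: partial_single zero_word_def flip: single_one)

lemma partial_\<xi>_mult: "partial q i (\<xi> j * x) = (if i = j then x else 0) + scale (q i j) (\<xi> j * partial q i x)"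
proof (induction x rule: poly_mapping_additive_induct)
  case (single k v)
  have *: "\<xi> j * Poly_Mapping.single k v = Poly_Mapping.single (Word (j # letters k)) v"
    by (simp add: \<xi>_def mult_single plus_word_def)
  show ?case
    unfolding * by (simp add: partial_single freealg.scale_right_distrib scale_single mult_scale_right mult.commute)
next
  case (sum f g)
  then show ?case by (simp add: partial_add distrib_left freealg.scale_right_distrib)
qed

lemma partial_unique:
  assumes lin: "Vector_Spaces.linear scale scale D"
    and one: "D 1 = 0"
    and gen: "\<And>j x. D (\<xi> j * x) = (if i = j then x else 0) + scale (q i j) (\<xi> j * D x)"
  shows "D = partial q i"
proof
  interpret D: Vector_Spaces.linear scale scale D by (rule lin)
  have word: "D (Poly_Mapping.single (Word w) 1) = partial_word q i w" for w
  proof (induction w)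
    case Nil
    then show ?case using one by (simp flip: single_one zero_word_def)
  next
    case (Cons j w)
    have "Poly_Mapping.single (Word (j # w)) 1 = \<xi> j * Poly_Mapping.single (Word w) 1"
      by (simp add: \<xi>_def mult_single plus_word_def)
    then show ?case using Cons by (simp add: gen)
  qed
  show "D x = partial q i x" for x
  proof (induction x rule: poly_mapping_additive_induct)
    case (single k v)
    have "Poly_Mapping.single k v = scale v (Poly_Mapping.single (Word (letters k)) 1)"
      by (simp add: scale_single)
    then show ?case by (simp only: D.scale word partial_scale) (simp add: partial_single)
  next
    case (sum f g)
    then show ?case by (simp add: D.add partial_add)
  qed
qed

lemma partial_in_\<B>:
  assumes "x \<in> \<B> N"
  shows "partial q i x \<in> \<B> N"
proof -
  have add: "x + y \<in> \<B> N" if "x \<in> \<B> N" "y \<in> \<B> N" for x y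
    using that keys_add[of x y] unfolding \<B>_def by blast
  have scale: "scale c x \<in> \<B> N" if "x \<in> \<B> N" for c x
    using that by (auto simp: \<B>_def in_keys_iff)
  have gen: "\<xi> j * x \<in> \<B> N" if "x \<in> \<B> N" "j \<in> {1..N}" for j x
    using that keys_mult[of "\<xi> j" x] by (fastforce simp: \<B>_def \<xi>_def plus_word_def)
  have zero: "0 \<in> \<B> N" by (simp add: \<B>_def)
  have word: "set w \<subseteq> {1..N} \<Longrightarrow> partial_word q i w \<in> \<B> N" for w
  proof (induction w)
    case (Cons j w)
    then have "(if i = j then Poly_Mapping.single (Word w) 1 else 0) \<in> \<B> N"
      by (simp add: \<B>_def)
    then show ?case using Cons by (auto intro!: add scale gen simp del: if_split)
  qed (simp add: zero)
  have sum: "finite A \<Longrightarrow> (\<forall>a\<in>A. f a \<in> \<B> N) \<Longrightarrow> sum f A \<in> \<B> N" for f and A :: "word set"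
    by (induction A rule: finite_induct) (auto intro: add zero)
  show ?thesis
    unfolding partial_def
  proof (intro sum ballI scale word)
    show "set (letters w) \<subseteq> {1..N}" if "w \<in> Poly_Mapping.keys x" for w
      using assms that unfolding \<B>_def by blast
  qed simp
qed

definition is_constant :: "nat \<Rightarrow> (nat \<Rightarrow> nat \<Rightarrow> complex) \<Rightarrow> freealg \<Rightarrow> bool" where
  "is_constant N q C \<longleftrightarrow>
     C \<in> \<B> N \<and> C \<noteq> 0 \<and> Poly_Mapping.lookup C 0 = 0 \<and> (\<forall>i\<in>{1..N}. partial q i C = 0)"

definition \<B>123 :: "freealg set" where
  "\<B>123 = freealg.span {\<xi> i * \<xi> j * \<xi> k | i j k. distinct [i, j, k] \<and> {i, j, k} = {1, 2, 3}}"

definition \<sigma> :: "(nat \<Rightarrow> nat \<Rightarrow> complex) \<Rightarrow> nat \<Rightarrow> nat \<Rightarrow> complex" where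
  "\<sigma> q i j = q i j * q j i"

definition \<sigma>123 :: "(nat \<Rightarrow> nat \<Rightarrow> complex) \<Rightarrow> complex" where
  "\<sigma>123 q = \<sigma> q 1 2 * \<sigma> q 1 3 * \<sigma> q 2 3"

end

theory Submission
  imports Defs
begin

text \<open>
  A polynomial \<open>C = \<Sum> c\<^sub>a\<^sub>b\<^sub>d \<xi>\<^sub>a \<xi>\<^sub>b \<xi>\<^sub>d\<close> in \<open>\<B>123\<close> is annihilated by all \<open>\<partial>\<^sub>i\<close> exactly if its six
  coefficients solve the six linear equations
  \<open>c\<^sub>a\<^sub>b\<^sub>d + q\<^sub>a\<^sub>b c\<^sub>b\<^sub>a\<^sub>d + q\<^sub>a\<^sub>b q\<^sub>a\<^sub>d c\<^sub>b\<^sub>d\<^sub>a = 0\<close>, one for the coefficient of \<open>\<xi>\<^sub>b \<xi>\<^sub>d\<close> in each \<open>\<partial>\<^sub>a C\<close>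
  (\<open>ex_constant_iff\<close>). The theorem says when this square system is singular, and the
  determinant is avoided by eliminating by hand.

  For the elimination, put \<open>S\<^sub>a\<^sub>b\<^sub>d = c\<^sub>a\<^sub>b\<^sub>d + q\<^sub>b\<^sub>d c\<^sub>a\<^sub>d\<^sub>b\<close>, which is the coefficient of \<open>\<xi>\<^sub>a \<xi>\<^sub>d\<close> in \<open>\<partial>\<^sub>b\<close> of
  \<open>C\<close> if only the words starting with \<open>\<xi>\<^sub>a\<close> are differentiated and the factor \<open>q\<^sub>b\<^sub>a\<close> is dropped.
  The equations then read \<open>c\<^sub>a\<^sub>b\<^sub>d = - q\<^sub>a\<^sub>b S\<^sub>b\<^sub>a\<^sub>d\<close>, so it suffices to show that every \<open>S\<close> vanishes. If
  \<open>\<sigma>\<^sub>a\<^sub>b \<noteq> 1\<close>, they also imply \<open>S\<^sub>a\<^sub>b\<^sub>d = \<sigma>\<^sub>a\<^sub>d q\<^sub>b\<^sub>d S\<^sub>a\<^sub>d\<^sub>b\<close> (\<open>twisted_sum_swap\<close>). Using this twice,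
  which needs \<open>\<sigma>\<^sub>a\<^sub>d \<noteq> 1\<close> as well, gives
  \<open>S\<^sub>a\<^sub>b\<^sub>d = \<sigma>\<^sub>1\<^sub>2\<^sub>3 S\<^sub>a\<^sub>b\<^sub>d\<close>, so \<open>\<sigma>\<^sub>1\<^sub>2\<^sub>3 \<noteq> 1\<close> forces \<open>S = 0\<close>.

  Conversely, if \<open>\<sigma>\<^sub>a\<^sub>b = 1\<close> then \<open>u = q\<^sub>a\<^sub>b \<xi>\<^sub>a \<xi>\<^sub>b - \<xi>\<^sub>b \<xi>\<^sub>a\<close> is a constant in two variables, and
  \<open>u \<xi>\<^sub>d - q\<^sub>d\<^sub>a q\<^sub>d\<^sub>b \<xi>\<^sub>d u\<close> is one in three (\<open>ex_solution_of_pair\<close>). If no \<open>\<sigma>\<^sub>a\<^sub>b\<close> is \<open>1\<close> but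
  \<open>\<sigma>\<^sub>1\<^sub>2\<^sub>3 = 1\<close>, the elimination leaves one free parameter; solving backwards from it
  gives a nonzero solution (\<open>ex_solution_of_triple\<close>).
\<close>

section \<open>Constants as solutions of a linear system\<close>

definition perm123 :: "nat \<Rightarrow> nat \<Rightarrow> nat \<Rightarrow> bool" where
  "perm123 a b d \<longleftrightarrow> distinct [a, b, d] \<and> {a, b, d} = {1, 2, 3}"

lemma perm123_iff:
  "perm123 a b d \<longleftrightarrow> (a, b, d) \<in> {(1,2,3), (1,3,2), (2,1,3), (2,3,1), (3,1,2), (3,2,1)}"
proof
  assume *: "perm123 a b d"
  then have "a \<in> {1,2,3}" "b \<in> {1,2,3}" "d \<in> {1,2,3}" "a \<noteq> b" "a \<noteq> d" "b \<noteq> d"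
    unfolding perm123_def by (simp_all, blast+)
  then show "(a, b, d) \<in> {(1,2,3), (1,3,2), (2,1,3), (2,3,1), (3,1,2), (3,2,1)}"
    by (elim insertE emptyE) simp_all
next
  assume "(a, b, d) \<in> {(1,2,3), (1,3,2), (2,1,3), (2,3,1), (3,1,2), (3,2,1)}"
  then show "perm123 a b d"
    by (elim insertE emptyE) (simp_all add: perm123_def insert_commute)
qed

lemma perm123_swap:
  assumes "perm123 a b d"
  shows "perm123 b a d" "perm123 a d b"
  using assms by (simp_all add: perm123_def insert_commute)

lemma all_perm123:
  assumes "perm123 a b d"
  shows "(\<forall>x y z. perm123 x y z \<longrightarrow> P x y z) \<longleftrightarrow>
     P a b d \<and> P a d b \<and> P b a d \<and> P b d a \<and> P d a b \<and> P d b a"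
proof -
  have "(\<forall>x y z. perm123 x y z \<longrightarrow> P x y z) \<longleftrightarrow>
     P 1 2 3 \<and> P 1 3 2 \<and> P 2 1 3 \<and> P 2 3 1 \<and> P 3 1 2 \<and> P 3 2 1"
    unfolding perm123_iff by blast
  with assms show ?thesis
    unfolding perm123_iff by (elim insertE emptyE) (simp_all only: prod.inject, blast+)
qed

lemma perm123_id: "perm123 1 2 3"
  by (simp add: perm123_def)

lemmas all_perm123_id = all_perm123[OF perm123_id]

definition solution :: "(nat \<Rightarrow> nat \<Rightarrow> complex) \<Rightarrow> (nat \<Rightarrow> nat \<Rightarrow> nat \<Rightarrow> complex) \<Rightarrow> bool" where
  "solution q c \<longleftrightarrow> (\<forall>a b d. perm123 a b d \<longrightarrow>
     c a b d + q a b * c b a d + q a b * q a d * c b d a = 0)"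

definition cubic :: "(nat \<Rightarrow> nat \<Rightarrow> nat \<Rightarrow> complex) \<Rightarrow> freealg" where
  "cubic c =
     Poly_Mapping.single (Word [1,2,3]) (c 1 2 3) + Poly_Mapping.single (Word [1,3,2]) (c 1 3 2) +
     Poly_Mapping.single (Word [2,1,3]) (c 2 1 3) + Poly_Mapping.single (Word [2,3,1]) (c 2 3 1) +
     Poly_Mapping.single (Word [3,1,2]) (c 3 1 2) + Poly_Mapping.single (Word [3,2,1]) (c 3 2 1)"

lemma \<xi>_mult_single: "\<xi> i * Poly_Mapping.single (Word w) v = Poly_Mapping.single (Word (i # w)) v"
  by (simp add: \<xi>_def mult_single plus_word_def)

lemma \<xi>_cubic_word: "\<xi> i * \<xi> j * \<xi> k = Poly_Mapping.single (Word [i, j, k]) 1"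
  by (simp add: \<xi>_def mult_single plus_word_def)

lemma lookup_cubic:
  assumes "perm123 a b d"
  shows "Poly_Mapping.lookup (cubic c) (Word [a, b, d]) = c a b d"
  using assms by (auto simp: perm123_iff cubic_def lookup_add lookup_single)

lemma keys_cubic:
  "Poly_Mapping.keys (cubic c) \<subseteq> {Word [a, b, d] | a b d. perm123 a b d}"
proof
  fix w assume "w \<in> Poly_Mapping.keys (cubic c)"
  then have "Poly_Mapping.lookup (cubic c) w \<noteq> 0"
    by (simp add: in_keys_iff)
  then have "w \<in> {Word [1,2,3], Word [1,3,2], Word [2,1,3], Word [2,3,1], Word [3,1,2], Word [3,2,1]}"
    by (auto simp: cubic_def lookup_add lookup_single when_def split: if_splits)
  then show "w \<in> {Word [a, b, d] | a b d. perm123 a b d}"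
    by (auto simp: perm123_iff)
qed

lemma cubic_eq_0_iff: "cubic c = 0 \<longleftrightarrow> (\<forall>a b d. perm123 a b d \<longrightarrow> c a b d = 0)"
proof
  assume "cubic c = 0"
  then show "\<forall>a b d. perm123 a b d \<longrightarrow> c a b d = 0"
    by (metis lookup_cubic lookup_zero)
next
  assume "\<forall>a b d. perm123 a b d \<longrightarrow> c a b d = 0"
  then show "cubic c = 0"
    by (simp add: all_perm123_id cubic_def)
qed

lemma \<B>123_eq: "\<B>123 = range cubic"
proof (intro equalityI subsetI)
  fix C assume "C \<in> \<B>123"
  then show "C \<in> range cubic"
    unfolding \<B>123_def
  proof (induction rule: freealg.span_induct_alt)
    case base
    have "cubic (\<lambda>_ _ _. 0) = 0"
      by (simp add: cubic_def)
    then show ?case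
      by (metis rangeI)
  next
    case (step r x y)
    then obtain i j k c where x: "x = Poly_Mapping.single (Word [i, j, k]) 1" and ijk: "perm123 i j k"
      and y: "y = cubic c"
      by (auto simp: perm123_def \<xi>_cubic_word)
    have "scale r x + y = cubic (\<lambda>a b d. (if (a, b, d) = (i, j, k) then r else 0) + c a b d)"
      using ijk unfolding perm123_iff
      by (elim insertE emptyE; simp add: x y cubic_def scale_single single_add add_ac)
    then show ?case
      by simp
  qed
next
  fix C assume "C \<in> range cubic"
  then obtain c where C: "C = cubic c"
    by auto
  have "Poly_Mapping.single (Word [a, b, d]) v \<in> \<B>123" if "perm123 a b d" for a b d v
  proof -
    have "scale v (\<xi> a * \<xi> b * \<xi> d) \<in> \<B>123"
      unfolding \<B>123_def using that
      by (intro freealg.span_scale freealg.span_base) (auto simp: perm123_def)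
    then show ?thesis
      by (simp add: \<xi>_cubic_word scale_single)
  qed
  then show "C \<in> \<B>123"
    unfolding C cubic_def \<B>123_def by (intro freealg.span_add) (auto simp: perm123_iff)
qed

lemma single_add_single_eq_0_iff:
  assumes "v \<noteq> w"
  shows "Poly_Mapping.single v x + Poly_Mapping.single w y = 0 \<longleftrightarrow> x = 0 \<and> y = (0::complex)"
proof
  assume "Poly_Mapping.single v x + Poly_Mapping.single w y = 0"
  then have "Poly_Mapping.lookup (Poly_Mapping.single v x + Poly_Mapping.single w y) u = 0" for u
    by simp
  from this[of v] this[of w] assms show "x = 0 \<and> y = 0"
    by (simp add: lookup_add lookup_single)
qed simp

lemma partial_cubic_word:
  "partial q i (Poly_Mapping.single (Word [a, b, d]) v) =
     Poly_Mapping.single (Word [b, d]) (if i = a then v else 0) +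
     Poly_Mapping.single (Word [a, d]) (if i = b then q i a * v else 0) +
     Poly_Mapping.single (Word [a, b]) (if i = d then q i a * q i b * v else 0)"
  by (simp add: partial_single distrib_left \<xi>_mult_single scale_single
      freealg.scale_right_distrib algebra_simps)

text \<open>
  Since \<open>\<partial>\<^sub>a\<close> removes the letter \<open>a\<close>, only the words \<open>b d\<close> and \<open>d b\<close> survive in \<open>\<partial>\<^sub>a C\<close>: the six
  equations come in three pairs.
\<close>

lemma partial_cubic:
  assumes "perm123 a b d"
  shows "partial q a (cubic c) =
     Poly_Mapping.single (Word [b, d]) (c a b d + q a b * c b a d + q a b * q a d * c b d a) +
     Poly_Mapping.single (Word [d, b]) (c a d b + q a d * c d a b + q a d * q a b * c d b a)"
  using assms unfolding perm123_iff
  by (elim insertE emptyE; simp add: cubic_def partial_add partial_cubic_word single_add ac_simps)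

lemma partial_cubic_eq_0_iff:
  assumes "perm123 a b d"
  shows "partial q a (cubic c) = 0 \<longleftrightarrow>
     c a b d + q a b * c b a d + q a b * q a d * c b d a = 0 \<and>
     c a d b + q a d * c d a b + q a d * q a b * c d b a = 0"
  unfolding partial_cubic[OF assms] using assms
  by (intro single_add_single_eq_0_iff) (simp add: perm123_def)

lemma partial_cubic_other:
  assumes "i \<notin> {1, 2, 3}"
  shows "partial q i (cubic c) = 0"
  using assms by (simp add: cubic_def partial_add partial_cubic_word)

lemma is_constant_cubic_iff:
  assumes "N \<ge> 3"
  shows "is_constant N q (cubic c) \<longleftrightarrow> (\<exists>a b d. perm123 a b d \<and> c a b d \<noteq> 0) \<and> solution q c"
proof -
  have mem: "cubic c \<in> \<B> N"
    using keys_cubic[of c] assms by (fastforce simp: \<B>_def perm123_iff)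
  have deg: "Poly_Mapping.lookup (cubic c) 0 = 0"
    using keys_cubic[of c] by (fastforce simp: zero_word_def in_keys_iff)
  have "(\<forall>i\<in>{1..N}. partial q i (cubic c) = 0) \<longleftrightarrow> (\<forall>i\<in>{1, 2, 3}. partial q i (cubic c) = 0)"
  proof
    assume *: "\<forall>i\<in>{1, 2, 3}. partial q i (cubic c) = 0"
    show "\<forall>i\<in>{1..N}. partial q i (cubic c) = 0"
      using * partial_cubic_other by metis
  qed (use assms in auto)
  also have "\<dots> \<longleftrightarrow> partial q 1 (cubic c) = 0 \<and> partial q 2 (cubic c) = 0 \<and> partial q 3 (cubic c) = 0"
    by simp
  also have "\<dots> \<longleftrightarrow> solution q c"
  proof -
    have perms: "perm123 1 2 3" "perm123 2 1 3" "perm123 3 1 2"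
      by (simp_all add: perm123_iff)
    show ?thesis
      unfolding perms[THEN partial_cubic_eq_0_iff] solution_def all_perm123_id by blast
  qed
  finally show ?thesis
    using mem deg by (auto simp: is_constant_def cubic_eq_0_iff)
qed

lemma ex_constant_iff:
  assumes "N \<ge> 3"
  shows "(\<exists>C\<in>\<B>123. is_constant N q C) \<longleftrightarrow>
    (\<exists>c a b d. solution q c \<and> perm123 a b d \<and> c a b d \<noteq> 0)"
  using is_constant_cubic_iff[OF assms] by (auto simp: \<B>123_eq)

section \<open>Elimination in the regular case\<close>

lemma \<sigma>_commute: "\<sigma> q a b = \<sigma> q b a"
  by (simp add: \<sigma>_def)

lemma \<sigma>123_eq:
  assumes "perm123 a b d"
  shows "\<sigma>123 q = \<sigma> q a b * \<sigma> q a d * \<sigma> q b d"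
  using assms by (auto simp: perm123_iff \<sigma>123_def \<sigma>_def)

text \<open>
  With \<open>S\<^sub>a\<^sub>b\<^sub>d = c\<^sub>a\<^sub>b\<^sub>d + q\<^sub>b\<^sub>d c\<^sub>a\<^sub>d\<^sub>b\<close>, adding \<open>q\<^sub>b\<^sub>d\<close> times the equation for \<open>a d b\<close> to the one for \<open>a b d\<close>
  gives \<open>S\<^sub>a\<^sub>b\<^sub>d + q\<^sub>a\<^sub>b S\<^sub>b\<^sub>a\<^sub>d + q\<^sub>a\<^sub>d q\<^sub>b\<^sub>d S\<^sub>d\<^sub>a\<^sub>b = 0\<close>. Exchanging \<open>a\<close> and \<open>b\<close> here and eliminating \<open>S\<^sub>b\<^sub>a\<^sub>d\<close>
  leaves \<open>(1 - \<sigma>\<^sub>a\<^sub>b) S\<^sub>a\<^sub>b\<^sub>d + q\<^sub>a\<^sub>d q\<^sub>b\<^sub>d (S\<^sub>d\<^sub>a\<^sub>b - q\<^sub>a\<^sub>b S\<^sub>d\<^sub>b\<^sub>a) = 0\<close>, and the last difference is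
  \<open>(1 - \<sigma>\<^sub>a\<^sub>b) c\<^sub>d\<^sub>a\<^sub>b\<close>. Cancel \<open>1 - \<sigma>\<^sub>a\<^sub>b\<close> and substitute \<open>c\<^sub>d\<^sub>a\<^sub>b = - q\<^sub>d\<^sub>a S\<^sub>a\<^sub>d\<^sub>b\<close>.
\<close>

lemma twisted_sum_swap:
  assumes "solution q c" "perm123 a b d" "\<sigma> q a b \<noteq> 1"
  shows "c a b d + q b d * c a d b = \<sigma> q a d * q b d * (c a d b + q d b * c a b d)"
proof -
  have E: "c x y z + q x y * c y x z + q x y * q x z * c y z x = 0" if "perm123 x y z" for x y z
    using assms(1) that unfolding solution_def by blast
  note perms = assms(2) perm123_swap[OF assms(2)]
  have 1: "c a b d + q a b * c b a d + q a b * q a d * c b d a = 0"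
    and 2: "c a d b + q a d * c d a b + q a d * q a b * c d b a = 0"
    and 3: "c b a d + q b a * c a b d + q b a * q b d * c a d b = 0"
    and 4: "c b d a + q b d * c d b a + q b d * q b a * c d a b = 0"
    and 5: "c d a b + q d a * c a d b + q d a * q d b * c a b d = 0"
    using E perms perm123_swap by blast+
  have "(1 - \<sigma> q a b) * (c a b d + q b d * c a d b + q a d * q b d * c d a b) = 0"
    using 1 2 3 4 unfolding \<sigma>_def by algebra
  then have "c a b d + q b d * c a d b + q a d * q b d * c d a b = 0"
    using assms(3) by simp
  then show ?thesis
    using 5 unfolding \<sigma>_def by algebra
qed

lemma solution_trivial:
  assumes sol: "solution q c" and "\<And>x y z. perm123 x y z \<Longrightarrow> \<sigma> q x y \<noteq> 1"
    and "\<sigma>123 q \<noteq> 1" and abd: "perm123 a b d"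
  shows "c a b d = 0"
proof -
  define S where "S x y z = c x y z + q y z * c x z y" for x y z
  have swap: "S x y z = \<sigma> q x z * q y z * S x z y" if "perm123 x y z" for x y z
    using twisted_sum_swap[OF sol that] assms(2) that unfolding S_def by blast
  have bad: "perm123 b a d"
    using abd by (rule perm123_swap)
  have "S b a d = \<sigma> q b d * q a d * S b d a"
    using swap bad by blast
  also have "S b d a = \<sigma> q b a * q d a * S b a d"
    using swap perm123_swap(2)[OF bad] by blast
  finally have "(1 - \<sigma>123 q) * S b a d = 0"
    unfolding \<sigma>123_eq[OF bad] \<sigma>_def by algebra
  then have "S b a d = 0"
    using assms(3) by simp
  moreover have "c a b d + q a b * S b a d = 0"
    using sol abd unfolding solution_def S_def by (simp add: algebra_simps)
  ultimately show ?thesis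
    by simp
qed

section \<open>Nonzero solutions in the singular cases\<close>

text \<open>
  These are the coefficients of \<open>u \<xi>\<^sub>d - q\<^sub>d\<^sub>a q\<^sub>d\<^sub>b \<xi>\<^sub>d u\<close> with \<open>u = q\<^sub>a\<^sub>b \<xi>\<^sub>a \<xi>\<^sub>b - \<xi>\<^sub>b \<xi>\<^sub>a\<close>. The operators
  \<open>\<partial>\<^sub>a\<close> and \<open>\<partial>\<^sub>b\<close> kill \<open>u\<close>, hence both products, while \<open>\<partial>\<^sub>d\<close> maps \<open>u \<xi>\<^sub>d\<close> to \<open>q\<^sub>d\<^sub>a q\<^sub>d\<^sub>b u\<close> and \<open>\<xi>\<^sub>d u\<close> to \<open>u\<close>.
\<close>

lemma ex_solution_of_pair:
  assumes "perm123 a b d" "\<sigma> q a b = 1"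
  shows "\<exists>c a b d. solution q c \<and> perm123 a b d \<and> c a b d \<noteq> 0"
proof -
  define c where "c x y z =
    (if (x, y, z) = (a, b, d) then q a b
     else if (x, y, z) = (b, a, d) then -1
     else if (x, y, z) = (d, a, b) then - q d a * q d b * q a b
     else if (x, y, z) = (d, b, a) then q d a * q d b else 0)" for x y z
  have "a \<noteq> b" "a \<noteq> d" "b \<noteq> d"
    using assms(1) by (simp_all add: perm123_def)
  then have vals: "c a b d = q a b" "c b a d = -1" "c d a b = - q d a * q d b * q a b"
    "c d b a = q d a * q d b" "c a d b = 0" "c b d a = 0"
    by (simp_all add: c_def)
  have 1: "q a b * q b a = 1"
    using assms(2) by (simp add: \<sigma>_def)
  have "solution q c"
    unfolding solution_def all_perm123[OF assms(1)] vals using 1 by (intro conjI) (algebra | simp)+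
  moreover have "perm123 b a d" "c b a d \<noteq> 0"
    using perm123_swap(1)[OF assms(1)] vals by simp_all
  ultimately show ?thesis
    by blast
qed

text \<open>
  Where no \<open>\<sigma>\<^sub>a\<^sub>b\<close> is \<open>1\<close>, the coefficients arise as follows. The relation \<open>S\<^sub>1\<^sub>2\<^sub>3 = \<sigma>\<^sub>1\<^sub>3 q\<^sub>2\<^sub>3 S\<^sub>1\<^sub>3\<^sub>2\<close> of
  \<open>twisted_sum_swap\<close> and \<open>S\<^sub>1\<^sub>2\<^sub>3 - q\<^sub>2\<^sub>3 S\<^sub>1\<^sub>3\<^sub>2 = (1 - \<sigma>\<^sub>2\<^sub>3) c\<^sub>1\<^sub>2\<^sub>3\<close> suggest to choose
  \<open>S\<^sub>1\<^sub>3\<^sub>2 = 1 - \<sigma>\<^sub>2\<^sub>3\<close>, which determines the rest. As \<open>\<sigma>\<^sub>1\<^sub>2\<^sub>3 = 1\<close> makes the inverse of every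
  \<open>q\<^sub>a\<^sub>b\<close> (\<open>a \<noteq> b\<close>) a product of other ones, denominators disappear, and the resulting formulas solve
  the system whatever the single \<open>\<sigma>\<^sub>a\<^sub>b\<close> are; \<open>\<sigma>\<^sub>2\<^sub>3 \<noteq> 1\<close> makes \<open>c\<^sub>3\<^sub>1\<^sub>2 = - q\<^sub>3\<^sub>1 S\<^sub>1\<^sub>3\<^sub>2\<close> nonzero.
\<close>

lemma ex_solution_of_triple:
  assumes "\<sigma>123 q = 1" "\<sigma> q 2 3 \<noteq> 1"
  shows "\<exists>c a b d. solution q c \<and> perm123 a b d \<and> c a b d \<noteq> 0"
proof -
  define c where "c x y z =
    (if (x, y, z) = (1, 2, 3) then q 2 3 * (\<sigma> q 1 3 - 1)
     else if (x, y, z) = (1, 3, 2) then 1 - \<sigma> q 1 3 * \<sigma> q 2 3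
     else if (x, y, z) = (2, 1, 3) then q 2 1 * q 2 3 * \<sigma> q 1 3 * (\<sigma> q 2 3 - 1)
     else if (x, y, z) = (2, 3, 1) then q 2 1 * q 2 3 * q 3 1 * \<sigma> q 1 3 * \<sigma> q 2 3 * (\<sigma> q 1 2 - 1)
     else if (x, y, z) = (3, 1, 2) then q 3 1 * (\<sigma> q 2 3 - 1)
     else q 2 1 * q 3 1 * \<sigma> q 2 3 * (\<sigma> q 1 3 - 1))" for x y z :: nat
  have vals: "c 1 2 3 = q 2 3 * (\<sigma> q 1 3 - 1)" "c 1 3 2 = 1 - \<sigma> q 1 3 * \<sigma> q 2 3"
    "c 2 1 3 = q 2 1 * q 2 3 * \<sigma> q 1 3 * (\<sigma> q 2 3 - 1)"
    "c 2 3 1 = q 2 1 * q 2 3 * q 3 1 * \<sigma> q 1 3 * \<sigma> q 2 3 * (\<sigma> q 1 2 - 1)"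
    "c 3 1 2 = q 3 1 * (\<sigma> q 2 3 - 1)"
    "c 3 2 1 = q 2 1 * q 3 1 * \<sigma> q 2 3 * (\<sigma> q 1 3 - 1)"
    by (simp_all add: c_def)
  have 1: "q 1 2 * q 2 1 * (q 1 3 * q 3 1) * (q 2 3 * q 3 2) = 1"
    using assms(1) by (simp add: \<sigma>123_def \<sigma>_def)
  have "solution q c"
    unfolding solution_def all_perm123_id vals \<sigma>_def using 1 by (intro conjI) (algebra | simp)+
  moreover have "q 3 1 \<noteq> 0"
    using 1 by auto
  then have "c 3 1 2 \<noteq> 0"
    using assms(2) unfolding vals by simp
  moreover have "perm123 3 1 2"
    by (simp add: perm123_iff)
  ultimately show ?thesis
    by blast
qed

theorem mainTheorem4:
  fixes N :: nat and q :: "nat \<Rightarrow> nat \<Rightarrow> complex"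
  assumes "N \<ge> 3"
  shows "(\<exists>C\<in>\<B>123. is_constant N q C) \<longleftrightarrow>
    (\<sigma> q 1 2 - 1) * (\<sigma> q 2 3 - 1) * (\<sigma> q 1 3 - 1) * (\<sigma>123 q - 1) = 0"
  unfolding ex_constant_iff[OF assms]
proof
  assume *: "\<exists>c a b d. solution q c \<and> perm123 a b d \<and> c a b d \<noteq> 0"
  show "(\<sigma> q 1 2 - 1) * (\<sigma> q 2 3 - 1) * (\<sigma> q 1 3 - 1) * (\<sigma>123 q - 1) = 0"
  proof (rule ccontr)
    assume "\<not> ?thesis"
    then have "\<sigma> q 1 2 \<noteq> 1" "\<sigma> q 2 3 \<noteq> 1" "\<sigma> q 1 3 \<noteq> 1" and triple: "\<sigma>123 q \<noteq> 1"
      by auto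
    then have "\<sigma> q x y \<noteq> 1" if "perm123 x y z" for x y z
      using that \<sigma>_commute[of q] by (auto simp: perm123_iff)
    with * triple show False
      using solution_trivial by blast
  qed
next
  assume "(\<sigma> q 1 2 - 1) * (\<sigma> q 2 3 - 1) * (\<sigma> q 1 3 - 1) * (\<sigma>123 q - 1) = 0"
  then consider "\<sigma> q 1 2 = 1" | "\<sigma> q 2 3 = 1" | "\<sigma> q 1 3 = 1" | "\<sigma>123 q = 1" "\<sigma> q 2 3 \<noteq> 1"
    by auto
  then show "\<exists>c a b d. solution q c \<and> perm123 a b d \<and> c a b d \<noteq> 0"
  proof cases
    case 1
    then show ?thesis by (intro ex_solution_of_pair[of 1 2 3]) (auto simp: perm123_iff)
  next
    case 2
    then show ?thesis by (intro ex_solution_of_pair[of 2 3 1]) (auto simp: perm123_iff)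
  next
    case 3
    then show ?thesis by (intro ex_solution_of_pair[of 1 3 2]) (auto simp: perm123_iff)
  next
    case 4
    then show ?thesis by (rule ex_solution_of_triple)
  qed
qed

end
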